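(* For every $n\ge1$, the pseudoreachability order $\geq_P$ on $\mathfrak{S}_n$ is graded by length; that is, it is a graded poset whose rank function is $\ell$, so that whenever $x$ covers $y$ in $\geq_P$ one has $\ell(x)=\ell(y)+1$.
   Context: Notation: $[m,n]=\{m,\dots,n\}$, $[n]=[1,n]$. For $a,b\in\mathbb{Z}^n$, $a\leq_C b$ means $a(i)\leq b(i)$ for all $i$. For $x\in[n]^n$ the conjugate is $x^*=(n+1-x(n),\dots,n+1-x(1))$. $\mathfrak{S}_n$ is the group of permutations of $[n]$, and $\ell(x)$ is the length of $x\in\mathfrak{S}_n$, i.e., the number of pairs $i<j$ with $x(i)>x(j)$. Parking functions: cars $1,\dots,n$ enter, in this order, a one-way street with spots $1,\dots,n$. Given $a\in[n]^n$, car $i$ parks in the first (lowest-numbered) available spot in $[a(i),n]$; if there is none, the procedure fails. If all cars park, $a$ is a parking function, and its outcome is the permutation $\mathcal{O}(a)=w\in\mathfrak{S}_n$, where car $i$ parks in spot $w(i)$. Interval parking functions (IPFs): given $a,b\in[n]^n$ with $a\leq_C b$, car $i$ parks in the first available spot in $[a(i),b(i)]$; if there is none, the procedure fails. If all cars park, $(a,b)$ is an interval parking function. If $(a,b)$ is an IPF, then both $a$ and $b^*$ are parking functions. Reachability: for $x,y\in\mathfrak{S}_n$, $x\unrhd_R y$ means there exists an IPF $(a,b)$ with $x=\mathcal{O}(a)$ and $y=\mathcal{O}(b^* )^*$. This relation is reflexive and antisymmetric but not in general transitive. Pseudoreachability: $x\geq_P y$ if there is a sequence $x=x_0\unrhd_R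 x_1\unrhd_R\cdots\unrhd_R x_k=y$, i.e., $\geq_P$ is the transitive closure of $\unrhd_R$. It is a partial order on $\mathfrak{S}_n$. *)

theory Defs
  imports "HOL-Combinatorics.Multiset_Permutations"
begin

text \<open>
  A vector \<open>x \<in> [n]\<^sup>n\<close> is the list \<open>[x(1), \<dots>, x(n)]\<close>, so that \<open>x(i)\<close> is \<open>x ! (i - 1)\<close>.
  A permutation of \<open>[n]\<close> is such a list in one-line notation, and the carrier of the
  symmetric group is \<^term>\<open>permutations_of_set {1..n}\<close>.
\<close>

definition vectors :: "nat \<Rightarrow> nat list set" where
  "vectors n = {x. length x = n \<and> set x \<subseteq> {1..n}}"

abbreviation Sym :: "nat \<Rightarrow> nat list set" where
  "Sym n \<equiv> permutations_of_set {1..n}"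

definition conjugate :: "nat \<Rightarrow> nat list \<Rightarrow> nat list" where
  "conjugate n x = map (\<lambda>v. n + 1 - v) (rev x)"

definition perm_length :: "nat list \<Rightarrow> nat" where
  "perm_length x = card {(i, j). i < j \<and> j < length x \<and> x ! i > x ! j}"


text \<open>
  \<open>park occ ivs\<close>: the cars with preference intervals \<open>ivs\<close> enter in list order while the
  spots in \<open>occ\<close> are taken. The result lists the spots in which they park, and is \<^term>\<open>None\<close>
  if some car fails to park.
\<close>

fun park :: "nat set \<Rightarrow> (nat \<times> nat) list \<Rightarrow> nat list option" where
  "park occ [] = Some []"
| "park occ ((lo, hi) # ivs) =
     (if {lo..hi} - occ = {} then None
      else let s = Min ({lo..hi} - occ) in map_option ((#) s) (park (insert s occ) ivs))"

definition interval_parking_function :: "nat \<Rightarrow> nat list \<Rightarrow> nat list \<Rightarrow> bool" where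
  "interval_parking_function n a b \<longleftrightarrow>
     a \<in> vectors n \<and> b \<in> vectors n \<and> list_all2 (\<le>) a b \<and> park {} (zip a b) \<noteq> None"

text \<open>
  For \<open>a \<in> [n]\<^sup>n\<close>, \<open>outcome n a = Some w\<close> says that \<open>a\<close> is a parking function with
  outcome \<open>w\<close>.
\<close>

definition outcome :: "nat \<Rightarrow> nat list \<Rightarrow> nat list option" where
  "outcome n a = park {} (map (\<lambda>v. (v, n)) a)"

definition reachable :: "nat \<Rightarrow> nat list \<Rightarrow> nat list \<Rightarrow> bool" where
  "reachable n x y \<longleftrightarrow> x \<in> Sym n \<and> y \<in> Sym n \<and>
     (\<exists>a b. interval_parking_function n a b \<and> outcome n a = Some x \<and>
        (\<exists>w. outcome n (conjugate n b) = Some w \<and> y = conjugate n w))"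

text \<open>
  The order relation, as a set of pairs (smaller element, larger element).
\<close>

definition pseudoreach_order :: "nat \<Rightarrow> (nat list \<times> nat list) set" where
  "pseudoreach_order n = {(y, x). (reachable n)\<^sup>+\<^sup>+ x y}"


text \<open>
  Throughout, an order is a relation \<open>r\<close> on a carrier \<open>A\<close>, and \<open>(y, x) \<in> r\<close> means \<open>y \<le> x\<close>.
\<close>

definition covers :: "('a \<times> 'a) set \<Rightarrow> 'a \<Rightarrow> 'a \<Rightarrow> bool" where
  "covers r x y \<longleftrightarrow> (y, x) \<in> r \<and> y \<noteq> x \<and>
     \<not> (\<exists>z. z \<noteq> x \<and> z \<noteq> y \<and> (y, z) \<in> r \<and> (z, x) \<in> r)"

definition maximal_chains :: "'a set \<Rightarrow> ('a \<times> 'a) set \<Rightarrow> 'a set set" where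
  "maximal_chains A r =
     {C. C \<subseteq> A \<and> C \<in> Chains r \<and> (\<forall>D. D \<subseteq> A \<and> D \<in> Chains r \<and> C \<subseteq> D \<longrightarrow> D = C)}"

text \<open>
  Gradedness in Stanley's sense: all maximal chains have the same length, where a chain
  of \<open>k + 1\<close> elements has length \<open>k\<close>. The rank function is then \<open>0\<close> on minimal elements and
  increases by \<open>1\<close> along covers.
\<close>

definition graded_poset :: "'a set \<Rightarrow> ('a \<times> 'a) set \<Rightarrow> bool" where
  "graded_poset A r \<longleftrightarrow> partial_order_on A r \<and>
     (\<exists>k. \<forall>C \<in> maximal_chains A r. finite C \<and> card C = k + 1)"

definition rank_function :: "'a set \<Rightarrow> ('a \<times> 'a) set \<Rightarrow> ('a \<Rightarrow> nat) \<Rightarrow> bool" where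
  "rank_function A r \<rho> \<longleftrightarrow>
     (\<forall>x \<in> A. (\<forall>y \<in> A. (y, x) \<in> r \<longrightarrow> y = x) \<longrightarrow> \<rho> x = 0) \<and>
     (\<forall>x \<in> A. \<forall>y \<in> A. covers r x y \<longrightarrow> \<rho> x = \<rho> y + 1)"

end

theory Submission
  imports Defs
begin

text \<open>
  The idea is to give each permutation \<open>x\<close> an inversion code, whose entry at position \<open>j\<close>
  counts the larger values to the left of \<open>j\<close>, and to show that pseudoreachability is the
  componentwise order of codes. The length of a permutation is the sum of its code, so lowering
  one entry by one lowers the length by one.

  Parking disappears first. If \<open>(a, b)\<close> is an interval parking function then the upper ends
  \<open>b\<close> never influence where the cars park, so all that \<open>a\<close> contributes is its outcome \<open>x\<close>,
  and \<open>x\<close> lies below \<open>b\<close>. Conjugation turns the second outcome \<open>y\<close> into parking in the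
  opposite sense: the cars enter in reverse order, and each takes the last free spot up to its
  entry of \<open>b\<close>. Hence \<open>x\<close> reaches \<open>y\<close> exactly when, for every car \<open>i\<close>, all spots above \<open>y(i)\<close>
  and up to \<open>x(i)\<close> are held in \<open>y\<close> by cars after \<open>i\<close> (\<open>reachable_iff\<close>).

  Two facts then give the order. Under this condition \<open>y\<close> is greedy: on every final segment
  of cars it uses at least as many spots above any threshold as \<open>x\<close> does
  (\<open>card_above_le_of_filled\<close>), and complementary counting turns this into \<open>code y \<le> code x\<close>
  (\<open>reachable_imp_code_le\<close>). Conversely, any positive code entry can be lowered by one, leaving
  the others alone, by a single transposition that is itself a reachability step
  (\<open>reachable_code_decrement\<close>). A permutation is determined by its code, so such steps lead
  from any code down to any smaller one (\<open>pseudoreach_order_iff\<close>).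

  Each strict inequality \<open>y < x\<close> can thus be refined by an element of length one less than that
  of \<open>x\<close>. In a bounded poset this forces every maximal chain to meet each rank exactly once
  (\<open>maximal_chain_meets_every_rank\<close>); here the bounds are the identity and its reversal.
\<close>

section \<open>Graded posets from one-step descents\<close>

lemma strict_rank_from_descents:
  fixes \<rho> :: "'a \<Rightarrow> nat"
  assumes descent: "\<And>x y. (y, x) \<in> r \<Longrightarrow> y \<noteq> x \<Longrightarrow>
      \<exists>z. (y, z) \<in> r \<and> (z, x) \<in> r \<and> \<rho> x = \<rho> z + 1"
    and "(y, x) \<in> r" "y \<noteq> x"
  shows "\<rho> y < \<rho> x"
  using assms(2,3)
proof (induction "\<rho> x" arbitrary: x rule: less_induct)
  case less
  obtain z where z: "(y, z) \<in> r" "\<rho> x = \<rho> z + 1"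
    using descent[OF less.prems] by blast
  show ?case
  proof (cases "y = z")
    case False
    then have "\<rho> y < \<rho> z" using less.hyps[of z] z by simp
    then show ?thesis using z by simp
  qed (use z in simp)
qed

text \<open>
  Two elements of a chain cannot have the same rank. If a maximal chain missed the rank \<open>m\<close>, let
  \<open>y < x\<close> be its neighbours on either side of the gap: the descent property puts an element \<open>z\<close>
  directly below \<open>x\<close> and above \<open>y\<close>, which is comparable to the whole chain and so belongs to it,
  although its rank lies in the gap.
\<close>

lemma maximal_chain_meets_every_rank:
  fixes \<rho> :: "'a \<Rightarrow> nat"
  assumes po: "partial_order_on A r"
    and lo: "lo \<in> A" "\<And>x. x \<in> A \<Longrightarrow> (lo, x) \<in> r" "\<rho> lo = 0"
    and hi: "hi \<in> A" "\<And>x. x \<in> A \<Longrightarrow> (x, hi) \<in> r"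
    and descent: "\<And>x y. (y, x) \<in> r \<Longrightarrow> y \<noteq> x \<Longrightarrow>
      \<exists>z. (y, z) \<in> r \<and> (z, x) \<in> r \<and> \<rho> x = \<rho> z + 1"
    and C: "C \<in> maximal_chains A r"
  shows "bij_betw \<rho> C {..\<rho> hi}"
proof -
  have rA: "r \<subseteq> A \<times> A" and refl: "\<And>x. x \<in> A \<Longrightarrow> (x, x) \<in> r" and tr: "trans r"
    using po by (auto simp: partial_order_on_def preorder_on_def refl_on_def)
  have strict: "\<rho> y < \<rho> x" if "(y, x) \<in> r" "y \<noteq> x" for x y
    using strict_rank_from_descents[of r \<rho>] descent that by blast
  have CA: "C \<subseteq> A" and chain: "\<And>x y. x \<in> C \<Longrightarrow> y \<in> C \<Longrightarrow> (x, y) \<in> r \<or> (y, x) \<in> r"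
    and maxi: "\<And>D. D \<subseteq> A \<Longrightarrow> D \<in> Chains r \<Longrightarrow> C \<subseteq> D \<Longrightarrow> D = C"
    using C by (auto simp: maximal_chains_def Chains_def)
  have absorb: "z \<in> C" if "z \<in> A" "\<And>c. c \<in> C \<Longrightarrow> (c, z) \<in> r \<or> (z, c) \<in> r" for z
  proof -
    have "insert z C \<in> Chains r"
      using that chain refl by (auto simp: Chains_def)
    then show ?thesis using maxi[of "insert z C"] CA that(1) by blast
  qed
  have loC: "lo \<in> C" and hiC: "hi \<in> C"
    using lo hi CA by (auto intro!: absorb)
  have inj: "inj_on \<rho> C"
    by (rule inj_onI) (metis chain strict less_irrefl)
  have "\<rho> c \<le> \<rho> hi" if "c \<in> C" for c
    using that strict[of c hi] hi CA by (cases "c = hi") (auto simp: subset_iff)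
  moreover have "\<exists>c\<in>C. \<rho> c = m" if m: "m \<le> \<rho> hi" for m
  proof -
    \<comment> \<open>the lowest element of the chain of rank at least \<open>m\<close>\<close>
    obtain x where x: "x \<in> C" "m \<le> \<rho> x" and xmin: "\<And>c. c \<in> C \<Longrightarrow> m \<le> \<rho> c \<Longrightarrow> \<rho> x \<le> \<rho> c"
      using ex_has_least_nat[of "\<lambda>c. c \<in> C \<and> m \<le> \<rho> c" hi \<rho>] hiC m by blast
    show ?thesis
    proof (rule ccontr)
      assume none: "\<not> (\<exists>c\<in>C. \<rho> c = m)"
      then have xm: "m < \<rho> x" using x by (metis le_neq_implies_less)
      have m0: "0 < m" using none loC lo(3) by (cases m) auto
      \<comment> \<open>the highest element of the chain of rank below \<open>m\<close>\<close>
      obtain y where y: "y \<in> C" "\<rho> y < m" and ymax: "\<And>c. c \<in> C \<Longrightarrow> \<rho> c < m \<Longrightarrow> \<rho> c \<le> \<rho> y"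
        using ex_has_greatest_nat[of "\<lambda>c. c \<in> C \<and> \<rho> c < m" lo \<rho> m] loC lo(3) m0
        by (auto intro: less_imp_le)
      have "(y, x) \<in> r" "y \<noteq> x"
        using chain[OF x(1) y(1)] strict[of x y] x y xm by (fastforce)+
      then obtain z where z: "(y, z) \<in> r" "(z, x) \<in> r" "\<rho> x = \<rho> z + 1"
        using descent by blast
      have "z \<in> C"
      proof (rule absorb)
        show "z \<in> A" using z rA by blast
        fix c assume c: "c \<in> C"
        show "(c, z) \<in> r \<or> (z, c) \<in> r"
        proof (cases "m \<le> \<rho> c")
          case True
          then have "\<rho> x \<le> \<rho> c" using xmin c by blast
          then have "(x, c) \<in> r" using chain[OF x(1) c] strict[of c x] refl x CA by fastforce
          then show ?thesis using z tr by (meson transE)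
        next
          case False
          then have "\<rho> c \<le> \<rho> y" using ymax c by simp
          then have "(c, y) \<in> r" using chain[OF y(1) c] strict[of y c] refl y CA by fastforce
          then show ?thesis using z tr by (meson transE)
        qed
      qed
      then show False using xmin[of z] z xm by simp
    qed
  qed
  ultimately have "\<rho> ` C = {..\<rho> hi}" by (auto simp: image_iff)
  with inj show ?thesis by (simp add: bij_betw_def)
qed

text \<open>
  A cover leaves no room for a strict refinement, so the descent property applied to it yields
  its lower element.
\<close>

lemma graded_by_descents:
  fixes \<rho> :: "'a \<Rightarrow> nat"
  assumes po: "partial_order_on A r"
    and lo: "lo \<in> A" "\<And>x. x \<in> A \<Longrightarrow> (lo, x) \<in> r" "\<rho> lo = 0"
    and hi: "hi \<in> A" "\<And>x. x \<in> A \<Longrightarrow> (x, hi) \<in> r"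
    and descent: "\<And>x y. (y, x) \<in> r \<Longrightarrow> y \<noteq> x \<Longrightarrow>
      \<exists>z. (y, z) \<in> r \<and> (z, x) \<in> r \<and> \<rho> x = \<rho> z + 1"
  shows "graded_poset A r \<and> rank_function A r \<rho>"
proof
  have "finite C \<and> card C = \<rho> hi + 1" if "C \<in> maximal_chains A r" for C
    using maximal_chain_meets_every_rank[OF po lo hi descent that]
    by (auto simp: bij_betw_finite bij_betw_same_card)
  then show "graded_poset A r" using po by (auto simp: graded_poset_def)
  have "\<rho> x = \<rho> y + 1" if cov: "covers r x y" for x y
  proof -
    obtain z where z: "(y, z) \<in> r" "(z, x) \<in> r" "\<rho> x = \<rho> z + 1"
      using descent[of y x] cov by (auto simp: covers_def)
    then have "z = y" using cov by (auto simp: covers_def)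
    with z show ?thesis by simp
  qed
  then show "rank_function A r \<rho>"
    using lo by (auto simp: rank_function_def)
qed

section \<open>Reachability without parking\<close>

text \<open>
  The recursive parking procedure becomes a condition on each car separately: the spot is within
  the interval and free, and all earlier spots of the interval are taken.
\<close>

lemma park_eq_Some_iff:
  "park occ ivs = Some w \<longleftrightarrow> length w = length ivs \<and>
     (\<forall>i < length ivs. fst (ivs ! i) \<le> w ! i \<and> w ! i \<le> snd (ivs ! i) \<and>
        w ! i \<notin> occ \<union> set (take i w) \<and> {fst (ivs ! i)..<w ! i} \<subseteq> occ \<union> set (take i w))"
proof (induction occ ivs arbitrary: w rule: park.induct)
  case (1 occ)
  then show ?case by auto
next
  case (2 occ lo hi ivs)
  let ?free = "{lo..hi} - occ"
  let ?first = "\<lambda>s. lo \<le> s \<and> s \<le> hi \<and> s \<notin> occ \<and> {lo..<s} \<subseteq> occ"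
  have first: "?free \<noteq> {} \<and> Min ?free = s \<longleftrightarrow> ?first s" for s
  proof
    assume a: "?free \<noteq> {} \<and> Min ?free = s"
    then have "s \<in> ?free" using Min_in[of ?free] by auto
    moreover have "t \<in> occ" if "lo \<le> t" "t < s" for t
      using a that calculation Min_le[of ?free t] by (cases "t \<in> occ") auto
    ultimately show "?first s" by auto
  next
    assume s: "?first s"
    then have "s \<le> t" if "t \<in> ?free" for t
      using that by (meson DiffE atLeastAtMost_iff atLeastLessThan_iff not_le subsetD)
    then show "?free \<noteq> {} \<and> Min ?free = s" using s by (auto intro!: Min_eqI)
  qed
  show ?case
  proof (cases w)
    case Nil
    then show ?thesis by (auto simp: Let_def)
  next
    case (Cons s v)
    have "park occ ((lo, hi) # ivs) = Some w \<longleftrightarrow>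
        (?free \<noteq> {} \<and> Min ?free = s) \<and> park (insert s occ) ivs = Some v"
      by (auto simp: Cons Let_def)
    also have "\<dots> \<longleftrightarrow> ?first s \<and> park (insert s occ) ivs = Some v"
      by (simp only: first)
    also have "\<dots> \<longleftrightarrow> ?first s \<and> length v = length ivs \<and>
     (\<forall>i < length ivs. fst (ivs ! i) \<le> v ! i \<and> v ! i \<le> snd (ivs ! i) \<and>
        v ! i \<notin> insert s occ \<union> set (take i v) \<and> {fst (ivs ! i)..<v ! i} \<subseteq> insert s occ \<union> set (take i v))"
    proof (cases "?first s")
      case True
      then show ?thesis using 2[of s v] first[of s] by metis
    qed blast
    finally show ?thesis by (simp add: Cons All_less_Suc2) blast
  qed
qed

lemma Sym_iff: "x \<in> Sym n \<longleftrightarrow> distinct x \<and> set x = {1..n}"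
  by (auto simp: permutations_of_set_def)

lemma length_Sym: "x \<in> Sym n \<Longrightarrow> length x = n"
  by (metis Sym_iff distinct_card card_atLeastAtMost diff_Suc_1)

lemma nth_Sym: "x \<in> Sym n \<Longrightarrow> i < n \<Longrightarrow> 1 \<le> x ! i \<and> x ! i \<le> n"
  by (metis Sym_iff length_Sym nth_mem atLeastAtMost_iff)

lemma nth_Sym_eq_iff: "x \<in> Sym n \<Longrightarrow> i < n \<Longrightarrow> j < n \<Longrightarrow> x ! i = x ! j \<longleftrightarrow> i = j"
  by (metis Sym_iff length_Sym nth_eq_iff_index_eq)

lemma Sym_surj: "x \<in> Sym n \<Longrightarrow> v \<in> {1..n} \<Longrightarrow> \<exists>k<n. x ! k = v"
  by (metis Sym_iff length_Sym in_set_conv_nth)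

lemma length_conjugate [simp]: "length (conjugate n x) = length x"
  by (simp add: conjugate_def)

lemma nth_conjugate: "i < length x \<Longrightarrow> conjugate n x ! i = n + 1 - x ! (length x - Suc i)"
  by (simp add: conjugate_def rev_nth)

lemma conjugate_conjugate: "set x \<subseteq> {1..n} \<Longrightarrow> conjugate n (conjugate n x) = x"
  by (rule nth_equalityI) (auto simp: nth_conjugate subset_iff dest!: nth_mem)

text \<open>
  Suppose that the cars enter in reverse order and each takes the last free spot up to its
  preference. This is the condition under which they park at \<open>y\<close> when car \<open>i\<close> prefers
  the larger of \<open>x ! i\<close> and \<open>y ! i\<close>.
\<close>

definition overshoot_filled :: "nat \<Rightarrow> nat list \<Rightarrow> nat list \<Rightarrow> bool" where
  "overshoot_filled n x y \<longleftrightarrow>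
     (\<forall>i<n. \<forall>s. y ! i < s \<and> s \<le> x ! i \<longrightarrow> (\<exists>k. i < k \<and> k < n \<and> y ! k = s))"

text \<open>
  The pair \<open>(a, b)\<close> enters only through \<open>x \<le> b\<close> and the outcome of \<open>b\<close>. For the converse, take
  \<open>a = x\<close>, so that every car gets its preferred spot, and for \<open>b\<close> the least vector that allows
  both \<open>x\<close> and \<open>y\<close>, the pointwise maximum.
\<close>

lemma reachable_iff:
  "reachable n x y \<longleftrightarrow> x \<in> Sym n \<and> y \<in> Sym n \<and> overshoot_filled n x y"
proof (intro iffI conjI)
  assume R: "reachable n x y"
  then show xS: "x \<in> Sym n" and yS: "y \<in> Sym n" by (auto simp: reachable_def)
  from R obtain a b w v where ab: "a \<in> vectors n" "b \<in> vectors n"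
    and v: "park {} (zip a b) = Some v" and x: "outcome n a = Some x"
    and w: "outcome n (conjugate n b) = Some w" and y: "y = conjugate n w"
    by (auto simp: reachable_def interval_parking_function_def)
  have len: "length a = n" "length b = n" "length w = n"
    using ab w by (auto simp: vectors_def outcome_def park_eq_Some_iff)
  have bn: "b ! i \<le> n" "1 \<le> b ! i" if "i < n" for i
    using ab that by (auto simp: vectors_def subset_iff dest!: nth_mem)
  \<comment> \<open>raising all upper ends to \<open>n\<close> does not move any car\<close>
  have "outcome n a = Some v"
    using v bn len by (auto simp: outcome_def park_eq_Some_iff intro: order_trans)
  with x have "v = x" by simp
  then have xb: "x ! i \<le> b ! i" if "i < n" for i
    using v len that by (auto simp: park_eq_Some_iff)
  show "overshoot_filled n x y"
    unfolding overshoot_filled_def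
  proof (intro allI impI)
    fix i s assume i: "i < n" and s: "y ! i < s \<and> s \<le> x ! i"
    \<comment> \<open>the place of car \<open>i\<close> in the reversed order of the conjugate\<close>
    define i' where "i' = n - Suc i"
    have i': "i' < n" "n - Suc i' = i" using i by (auto simp: i'_def)
    have wi: "{n + 1 - b ! i..<w ! i'} \<subseteq> set (take i' w)"
      using w i' len by (auto simp: outcome_def park_eq_Some_iff nth_conjugate)
    have yi: "y ! i = n + 1 - w ! i'" using i len by (simp add: y nth_conjugate i'_def)
    have "s \<le> b ! i" "s \<le> n" using s xb[OF i] bn[OF i] by auto
    then have "n + 1 - s \<in> {n + 1 - b ! i..<w ! i'}" using s yi by auto
    then obtain l where l: "l < i'" "w ! l = n + 1 - s"
      using wi i' len by (auto simp: subset_iff in_set_conv_nth)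
    then have "y ! (n - Suc l) = s" using i' len \<open>s \<le> n\<close> by (simp add: y nth_conjugate)
    moreover have "i < n - Suc l" "n - Suc l < n" using l i' by auto
    ultimately show "\<exists>k. i < k \<and> k < n \<and> y ! k = s" by blast
  qed
next
  assume a: "x \<in> Sym n \<and> y \<in> Sym n \<and> overshoot_filled n x y"
  then have xS: "x \<in> Sym n" and yS: "y \<in> Sym n" and ov: "overshoot_filled n x y" by auto
  note len = length_Sym[OF xS] length_Sym[OF yS]
  define b where "b = map (\<lambda>i. max (x ! i) (y ! i)) [0..<n]"
  have lb: "length b = n" and nb: "\<And>i. i < n \<Longrightarrow> b ! i = max (x ! i) (y ! i)"
    by (auto simp: b_def)
  have fresh: "z ! i \<notin> set (take i z)" if "distinct z" "i < length z" for i and z :: "nat list"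
    using that by (auto simp: in_set_conv_nth nth_eq_iff_index_eq)
  have "x \<in> vectors n" using xS[unfolded Sym_iff] len by (auto simp: vectors_def)
  moreover have "b \<in> vectors n"
    using nth_Sym[OF xS] nth_Sym[OF yS] by (auto simp: vectors_def b_def max_def)
  moreover have "list_all2 (\<le>) x b" using len lb nb by (auto simp: list_all2_conv_all_nth)
  moreover have "park {} (zip x b) = Some x"
    using len lb nb fresh[of x] xS[unfolded Sym_iff] by (auto simp: park_eq_Some_iff)
  moreover have "outcome n x = Some x"
    using len fresh[of x] xS[unfolded Sym_iff] nth_Sym[OF xS]
    by (auto simp: outcome_def park_eq_Some_iff)
  moreover have "outcome n (conjugate n b) = Some (conjugate n y)"
  proof -
    have "distinct (conjugate n y)"
      using yS[unfolded Sym_iff] by (auto simp: conjugate_def distinct_map inj_on_def)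
    note fr = fresh[OF this]
    have "s \<in> set (take i (conjugate n y))"
      if i: "i < n" and s: "n + 1 - b ! (n - Suc i) \<le> s" "s < n + 1 - y ! (n - Suc i)" for i s
    proof -
      define i' where "i' = n - Suc i"
      have i': "i' < n" "n - Suc i' = i" using i by (auto simp: i'_def)
      have "y ! i' < n + 1 - s \<and> n + 1 - s \<le> x ! i'"
        using s nb[OF i'(1)] nth_Sym[OF xS i'(1)] nth_Sym[OF yS i'(1)] unfolding i'_def[symmetric]
        by (auto simp: max_def split: if_splits)
      then obtain k where k: "i' < k" "k < n" "y ! k = n + 1 - s"
        using ov i' unfolding overshoot_filled_def by blast
      then have "conjugate n y ! (n - Suc k) = s" "n - Suc k < i"
        using s len i' by (auto simp: nth_conjugate)
      then show ?thesis using i len by (auto simp: in_set_conv_nth intro!: exI[of _ "n - Suc k"])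
    qed
    then have "{conjugate n b ! i..<conjugate n y ! i} \<subseteq> set (take i (conjugate n y))"
      if "i < n" for i
      using that len lb by (auto simp: nth_conjugate)
    moreover have "conjugate n b ! i \<le> conjugate n y ! i" "conjugate n y ! i \<le> n" if "i < n" for i
      using that len lb nb[of "n - Suc i"] nth_Sym[OF yS, of "n - Suc i"]
      by (auto simp: nth_conjugate intro!: diff_le_mono2)
    ultimately show ?thesis
      using len lb fr by (simp add: outcome_def park_eq_Some_iff)
  qed
  moreover have "conjugate n (conjugate n y) = y"
    using yS[unfolded Sym_iff] conjugate_conjugate[of y n] by simp
  ultimately show "reachable n x y"
    using xS yS unfolding reachable_def interval_parking_function_def
    by (intro conjI exI[of _ x] exI[of _ b] exI[of _ "conjugate n y"]) auto
qed

section \<open>The inversion code\<close>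

definition code :: "nat list \<Rightarrow> nat \<Rightarrow> nat" where
  "code x j = card {i. i < j \<and> x ! i > x ! j}"

lemma perm_length_eq_sum_code: "perm_length x = (\<Sum>j<length x. code x j)"
proof -
  let ?S = "SIGMA j:{..<length x}. {i. i < j \<and> x ! i > x ! j}"
  have "{(i, j). i < j \<and> j < length x \<and> x ! i > x ! j} = prod.swap ` ?S" by force
  then have "perm_length x = card ?S"
    by (simp add: perm_length_def card_image)
  then show ?thesis by (simp add: code_def)
qed

text \<open>
  There are \<open>n - x ! j\<close> values larger than \<open>x ! j\<close>, to the left or to the right of it. This
  expresses the code through the final segment after \<open>j\<close>, where \<open>overshoot_filled\<close> gives
  information.
\<close>

lemma code_complement:
  assumes x: "x \<in> Sym n" and j: "j < n"
  shows "code x j + (x ! j + card {k \<in> {j<..<n}. x ! j < x ! k}) = n"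
proof -
  let ?L = "{i. i < j \<and> x ! i > x ! j}" and ?R = "{k \<in> {j<..<n}. x ! j < x ! k}"
  have "bij_betw ((!) x) (?L \<union> ?R) {x ! j<..n}"
    unfolding bij_betw_def
  proof
    show "inj_on ((!) x) (?L \<union> ?R)"
      using nth_Sym_eq_iff[OF x] j by (auto simp: inj_on_def)
    have "v \<in> (!) x ` (?L \<union> ?R)" if "v \<in> {x ! j<..n}" for v
    proof -
      have "v \<in> {1..n}" using that by auto
      then obtain k where "k < n" "x ! k = v" using Sym_surj[OF x] by blast
      moreover have "k \<noteq> j" using calculation that by auto
      ultimately show ?thesis using that by (cases "k < j") auto
    qed
    then show "(!) x ` (?L \<union> ?R) = {x ! j<..n}"
      using nth_Sym[OF x] j by auto
  qed
  then have "card (?L \<union> ?R) = n - x ! j" by (simp add: bij_betw_same_card)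
  moreover have "card (?L \<union> ?R) = card ?L + card ?R" by (rule card_Un_disjoint) auto
  ultimately show ?thesis using nth_Sym[OF x j] unfolding code_def by linarith
qed

text \<open>
  The function \<open>t + card {k \<in> J. t < f k}\<close> of the threshold \<open>t\<close> governs the comparison of codes.
  Raising the threshold from \<open>s\<close> to \<open>t\<close> loses exactly the values of \<open>f\<close> in between, so it is
  monotone, strictly so at a \<open>t\<close> that is not a value, and constant over an interval filled by
  values.
\<close>

lemma card_above_split:
  fixes f :: "'a \<Rightarrow> nat"
  assumes "finite J" "inj_on f J" "s \<le> t"
  shows "card {k \<in> J. s < f k} = card {k \<in> J. t < f k} + card ({s<..t} \<inter> f ` J)"
proof -
  have "card ({s<..t} \<inter> f ` J) = card (f ` {k \<in> J. s < f k \<and> f k \<le> t})"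
    by (rule arg_cong[of _ _ card]) auto
  also have "\<dots> = card {k \<in> J. s < f k \<and> f k \<le> t}"
    by (rule card_image) (rule inj_on_subset[OF assms(2)], auto)
  moreover have "card {k \<in> J. s < f k} = card {k \<in> J. t < f k} + card {k \<in> J. s < f k \<and> f k \<le> t}"
    using assms by (subst card_Un_disjoint[symmetric]) (auto intro!: arg_cong[of _ _ card])
  ultimately show ?thesis by simp
qed

lemma card_above_mono:
  fixes f :: "'a \<Rightarrow> nat"
  assumes "finite J" "inj_on f J" "s \<le> t"
  shows "s + card {k \<in> J. s < f k} \<le> t + card {k \<in> J. t < f k}"
proof -
  have "card ({s<..t} \<inter> f ` J) \<le> card {s<..t}" by (rule card_mono) auto
  then show ?thesis using card_above_split[OF assms] assms(3) by simp
qed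

lemma card_above_strict_mono:
  fixes f :: "'a \<Rightarrow> nat"
  assumes "finite J" "inj_on f J" "s < t" "t \<notin> f ` J"
  shows "s + card {k \<in> J. s < f k} < t + card {k \<in> J. t < f k}"
proof -
  have "card ({s<..t} \<inter> f ` J) < card {s<..t}"
    using assms(3,4) by (intro psubset_card_mono) auto
  then show ?thesis using card_above_split[of J f s t] assms by simp
qed

text \<open>
  Let \<open>m\<close> be the first number above \<open>t\<close> that \<open>g\<close> misses. Below \<open>m\<close> the function \<open>g\<close> takes every
  value, so \<open>f\<close> takes no more. Above \<open>m\<close>, the comparison is termwise: if \<open>f k \<ge> m\<close> then also
  \<open>g k \<ge> m\<close>, for otherwise \<open>m\<close> would lie in the filled interval from \<open>g k\<close> to \<open>f k\<close>.
\<close>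

lemma card_above_le_of_filled:
  fixes f g :: "'a \<Rightarrow> nat"
  assumes J: "finite J" and f: "inj_on f J" and g: "inj_on g J"
    and filled: "\<And>k. k \<in> J \<Longrightarrow> {g k<..f k} \<subseteq> g ` J"
  shows "card {k \<in> J. t < f k} \<le> card {k \<in> J. t < g k}"
proof -
  have "\<exists>m>t. m \<notin> g ` J"
    using infinite_super[of "{t<..}" "g ` J"] J infinite_Ioi by blast
  define m where "m = (LEAST m. t < m \<and> m \<notin> g ` J)"
  have m: "t < m" "m \<notin> g ` J"
    using LeastI_ex[OF \<open>\<exists>m>t. m \<notin> g ` J\<close>] unfolding m_def by auto
  have below: "v \<in> g ` J" if "t < v" "v < m" for v
    using not_less_Least[of v "\<lambda>m. t < m \<and> m \<notin> g ` J"] that unfolding m_def by auto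
  have le: "t \<le> m - 1" using m by simp
  have "{k \<in> J. m - 1 < f k} \<subseteq> {k \<in> J. m - 1 < g k}"
  proof safe
    fix k assume k: "k \<in> J" "m - 1 < f k"
    have "m \<notin> {g k<..f k}" using filled[OF k(1)] m by blast
    moreover have "g k \<noteq> m" using m k by blast
    ultimately show "m - 1 < g k" using k m by auto
  qed
  then have "card {k \<in> J. m - 1 < f k} \<le> card {k \<in> J. m - 1 < g k}"
    using J by (intro card_mono) auto
  moreover have "card ({t<..m - 1} \<inter> f ` J) \<le> card ({t<..m - 1} \<inter> g ` J)"
    using below m by (intro card_mono) auto
  ultimately show ?thesis
    using card_above_split[OF J f le] card_above_split[OF J g le] by simp
qed

lemma inj_on_nth_Sym: "x \<in> Sym n \<Longrightarrow> inj_on ((!) x) {j<..<n}"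
  by (auto simp: inj_on_def nth_Sym_eq_iff)

text \<open>
  A permutation is recovered from its code from right to left: once the entries after position \<open>i\<close>
  are known, \<open>code_complement\<close> gives the value at \<open>x ! i\<close> of a known function of the threshold,
  and this function is injective on the values still unused.
\<close>

lemma code_inject:
  assumes x: "x \<in> Sym n" and y: "y \<in> Sym n" and eq: "\<And>j. j < n \<Longrightarrow> code x j = code y j"
  shows "x = y"
proof (rule nth_equalityI)
  note len = length_Sym[OF x] length_Sym[OF y]
  show "length x = length y" using len by simp
  have "x ! i = y ! i" if "i < n" for i
    using that
  proof (induction "n - i" arbitrary: i rule: less_induct)
    case less
    have later: "x ! k = y ! k" if "k \<in> {i<..<n}" for k
      using less.hyps[of k] that by auto
    define c where "c t = t + card {k \<in> {i<..<n}. t < x ! k}" for t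
    have cy: "c t = t + card {k \<in> {i<..<n}. t < y ! k}" for t
      unfolding c_def using later by (auto intro!: arg_cong[of _ _ card])
    have c_eq: "c (x ! i) = c (y ! i)"
      using code_complement[OF x less.prems] code_complement[OF y less.prems] eq[OF less.prems]
      unfolding cy[of "y ! i"] unfolding c_def by linarith
    have "x ! i \<notin> (!) x ` {i<..<n}"
      using nth_Sym_eq_iff[OF x] less.prems by auto
    moreover have "y ! i \<notin> (!) x ` {i<..<n}"
      using nth_Sym_eq_iff[OF y] less.prems later by auto
    moreover have "c s < c t" if "s < t" "t \<notin> (!) x ` {i<..<n}" for s t
      unfolding c_def using card_above_strict_mono[OF _ inj_on_nth_Sym[OF x] that] by simp
    ultimately show ?case
      using c_eq by (metis less_irrefl linorder_neqE_nat)
  qed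
  then show "\<And>i. i < length x \<Longrightarrow> x ! i = y ! i" using len by simp
qed

section \<open>Pseudoreachability is the componentwise order of codes\<close>

text \<open>
  By \<open>code_complement\<close> the claim is that \<open>x ! j + card {k \<in> {j<..<n}. x ! j < x ! k}\<close> is at most
  the same expression for \<open>y\<close>. Domination on the final segment replaces the count for \<open>x\<close> by the
  count for \<open>y\<close> with the same threshold. Moving the threshold from \<open>x ! j\<close> to \<open>y ! j\<close> is then
  monotone if it goes up, and it changes nothing if it goes down, because the interval
  crossed is filled.
\<close>

lemma reachable_imp_code_le:
  assumes R: "reachable n x y" and j: "j < n"
  shows "code y j \<le> code x j"
proof -
  have x: "x \<in> Sym n" and y: "y \<in> Sym n" and ov: "overshoot_filled n x y"
    using R by (auto simp: reachable_iff)
  let ?J = "{j<..<n}"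
  let ?c = "\<lambda>z t. card {k \<in> ?J. t < z ! k}"
  have "x ! j + ?c x (x ! j) \<le> x ! j + ?c y (x ! j)"
  proof -
    have "{y ! k<..x ! k} \<subseteq> (!) y ` ?J" if "k \<in> ?J" for k
      using that ov by (fastforce simp: overshoot_filled_def)
    then show ?thesis
      using card_above_le_of_filled[OF _ inj_on_nth_Sym[OF x] inj_on_nth_Sym[OF y]] by simp
  qed
  also have "\<dots> \<le> y ! j + ?c y (y ! j)"
  proof (cases "x ! j \<le> y ! j")
    case True
    then show ?thesis using card_above_mono[OF _ inj_on_nth_Sym[OF y]] by simp
  next
    case False
    have "{y ! j<..x ! j} \<subseteq> (!) y ` ?J"
      using j ov by (fastforce simp: overshoot_filled_def)
    then have "{y ! j<..x ! j} \<inter> (!) y ` ?J = {y ! j<..x ! j}" by blast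
    then show ?thesis
      using card_above_split[OF _ inj_on_nth_Sym[OF y], of j "y ! j" "x ! j"] False by simp
  qed
  finally show ?thesis
    using code_complement[OF x j] code_complement[OF y j] by linarith
qed

text \<open>
  Exchange \<open>x ! j\<close> with the next larger value \<open>x ! i\<close> among the entries to its left. All values
  strictly between the two stand to the right of \<open>j\<close>, which makes the exchange a reachability
  step. It also means that no other entry up to \<open>j\<close> can tell the two values apart, and the
  entries after \<open>j\<close> still have the same set of values to their left, so the only change to the
  code is the loss of the inversion formed by the exchanged pair.
\<close>

lemma reachable_code_decrement:
  assumes x: "x \<in> Sym n" and j: "j < n" and pos: "code x j > 0"
  obtains z where "reachable n x z" "code x j = code z j + 1"
    "\<And>k. k < n \<Longrightarrow> k \<noteq> j \<Longrightarrow> code z k = code x k"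
proof -
  note len = length_Sym[OF x]
  let ?P = "\<lambda>i. i < j \<and> x ! j < x ! i"
  have "\<exists>i. ?P i" using pos by (auto simp: code_def card_gt_0_iff)
  then obtain i where i: "i < j" "x ! j < x ! i"
    and imin: "\<And>l. ?P l \<Longrightarrow> x ! i \<le> x ! l"
    using ex_has_least_nat[of ?P _ "\<lambda>l. x ! l"] by blast
  have i_le: "x ! j < x ! l \<longleftrightarrow> x ! i \<le> x ! l" if "l < j" for l
    using imin[of l] that i by auto
  have i_lt: "x ! j < x ! l \<longleftrightarrow> x ! i < x ! l" if "l < j" "l \<noteq> i" for l
    using i_le[of l] that nth_Sym_eq_iff[OF x, of l i] i j by auto
  define z where "z = x[i := x ! j, j := x ! i]"
  have zn: "z ! k = (if k = j then x ! i else if k = i then x ! j else x ! k)" if "k < n" for k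
    using that len i j by (auto simp: z_def nth_list_update)
  have zS: "z \<in> Sym n"
    using x len i j unfolding z_def Sym_iff by (simp add: set_swap distinct_swap)
  have "overshoot_filled n x z"
    unfolding overshoot_filled_def
  proof (intro allI impI)
    fix m s assume m: "m < n" and s: "z ! m < s \<and> s \<le> x ! m"
    then have mi: "m = i" using zn[OF m] i by (auto split: if_splits)
    then have s': "x ! j < s" "s \<le> x ! i" using s zn[of i] i j by auto
    obtain k where k: "k < n" "x ! k = s"
      using Sym_surj[OF x, of s] s' nth_Sym[OF x, of i] i j by auto
    show "\<exists>k. m < k \<and> k < n \<and> z ! k = s"
    proof (cases "s = x ! i")
      case True
      then show ?thesis using mi i j zn[of j] by (intro exI[of _ j]) auto
    next
      case False
      then have "j < k" using i_le[of k] k s' by (metis le_antisym less_irrefl linorder_neqE_nat)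
      then show ?thesis using k mi i zn[of k] by (intro exI[of _ k]) auto
    qed
  qed
  then have "reachable n x z" using x zS by (simp add: reachable_iff)
  moreover have "code x j = code z j + 1"
  proof -
    have "x ! l > x ! j \<longleftrightarrow> l = i \<or> z ! l > z ! j" if "l < j" for l
      using that i i_lt[OF that] j zn[of l] zn[of j] by (cases "l = i") simp_all
    then have "{l. l < j \<and> x ! l > x ! j} = insert i {l. l < j \<and> z ! l > z ! j}"
      using i by blast
    moreover have "i \<notin> {l. l < j \<and> z ! l > z ! j}" using i j by (simp add: zn)
    ultimately show ?thesis by (simp add: code_def)
  qed
  moreover have "code z k = code x k" if k: "k < n" "k \<noteq> j" for k
  proof -
    consider "k < j" | "j < k" using k by linarith
    then show ?thesis
    proof cases
      case 1
      have "z ! l > z ! k \<longleftrightarrow> x ! l > x ! k" if "l < k" for l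
        using that 1 j i i_lt[of l] i_lt[of k] nth_Sym_eq_iff[OF x, of k i] nth_Sym_eq_iff[OF x, of k j]
        by (auto simp: zn)
      then show ?thesis by (simp add: code_def cong: conj_cong)
    next
      case 2
      have zk: "z ! k = x ! k" using zn[of k] k 2 i by simp
      have tr: "transpose i j l < k" "x ! transpose i j l = z ! l" "z ! transpose i j l = x ! l"
        if "l < k" for l
        using that 2 i k zn[of l] zn[of i] zn[of j] by (auto simp: transpose_def)
      have "bij_betw (transpose i j) {l. l < k \<and> z ! l > z ! k} {l. l < k \<and> x ! l > x ! k}"
        by (rule bij_betw_byWitness[where f' = "transpose i j"]) (auto simp: tr zk)
      then show ?thesis by (simp add: code_def bij_betw_same_card)
    qed
  qed
  ultimately show thesis by (rule that)
qed

lemma reachable_descent_in_code_order: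
  assumes x: "x \<in> Sym n" and y: "y \<in> Sym n"
    and le: "\<And>j. j < n \<Longrightarrow> code y j \<le> code x j" and "y \<noteq> x"
  obtains z where "reachable n x z" "\<And>j. j < n \<Longrightarrow> code y j \<le> code z j"
    "perm_length x = perm_length z + 1"
proof -
  obtain j where j: "j < n" "code y j < code x j"
    using code_inject[OF x y] le \<open>y \<noteq> x\<close> by (metis le_neq_implies_less)
  then have "code x j > 0" by simp
  then obtain z where z: "reachable n x z" "code x j = code z j + 1"
    "\<And>k. k < n \<Longrightarrow> k \<noteq> j \<Longrightarrow> code z k = code x k"
    using reachable_code_decrement[OF x j(1)] by blast
  have zS: "z \<in> Sym n" using z by (simp add: reachable_iff)
  have "code y k \<le> code z k" if "k < n" for k
    using z(2) z(3)[OF that] le[OF that] j by (cases "k = j") simp_all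
  moreover have "perm_length x = perm_length z + 1"
    unfolding perm_length_eq_sum_code length_Sym[OF x] length_Sym[OF zS]
    using j z(2,3) by (simp add: sum.remove[of "{..<n}" j])
  ultimately show thesis using z(1) that by blast
qed

text \<open>
  Reachability itself is not transitive, but each of its steps lowers the code, and the
  transpositions supply enough steps to realise the full componentwise order.
\<close>

lemma pseudoreach_order_iff:
  "(y, x) \<in> pseudoreach_order n \<longleftrightarrow>
     x \<in> Sym n \<and> y \<in> Sym n \<and> (\<forall>j<n. code y j \<le> code x j)"
proof
  assume "(y, x) \<in> pseudoreach_order n"
  then have "(reachable n)\<^sup>+\<^sup>+ x y" by (simp add: pseudoreach_order_def)
  then show "x \<in> Sym n \<and> y \<in> Sym n \<and> (\<forall>j<n. code y j \<le> code x j)"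
  proof induction
    case (base y)
    then show ?case using reachable_imp_code_le by (auto simp: reachable_iff)
  next
    case (step y z)
    then show ?case using reachable_imp_code_le[of n y z]
      by (auto simp: reachable_iff intro: order_trans)
  qed
next
  assume "x \<in> Sym n \<and> y \<in> Sym n \<and> (\<forall>j<n. code y j \<le> code x j)"
  then have "(reachable n)\<^sup>+\<^sup>+ x y"
  proof (induction "perm_length x" arbitrary: x rule: less_induct)
    case less
    then have x: "x \<in> Sym n" and y: "y \<in> Sym n" and le: "\<And>j. j < n \<Longrightarrow> code y j \<le> code x j"
      by auto
    show ?case
    proof (cases "y = x")
      case True
      then show ?thesis using y by (auto simp: reachable_iff overshoot_filled_def)
    next
      case False
      obtain z where z: "reachable n x z" "\<And>j. j < n \<Longrightarrow> code y j \<le> code z j"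
        "perm_length x = perm_length z + 1"
        using reachable_descent_in_code_order[OF x y le False] by blast
      then have "(reachable n)\<^sup>+\<^sup>+ z y"
        using less.hyps[of z] y by (simp add: reachable_iff)
      with z(1) show ?thesis by (rule tranclp_into_tranclp2)
    qed
  qed
  then show "(y, x) \<in> pseudoreach_order n" by (simp add: pseudoreach_order_def)
qed

lemma pseudoreach_descent:
  assumes "(y, x) \<in> pseudoreach_order n" "y \<noteq> x"
  shows "\<exists>z. (y, z) \<in> pseudoreach_order n \<and> (z, x) \<in> pseudoreach_order n \<and>
    perm_length x = perm_length z + 1"
proof -
  have x: "x \<in> Sym n" and y: "y \<in> Sym n" and le: "\<And>j. j < n \<Longrightarrow> code y j \<le> code x j"
    using assms(1) by (auto simp: pseudoreach_order_iff)
  obtain z where z: "reachable n x z" "\<And>j. j < n \<Longrightarrow> code y j \<le> code z j"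
    "perm_length x = perm_length z + 1"
    using reachable_descent_in_code_order[OF x y le assms(2)] by blast
  have "(y, z) \<in> pseudoreach_order n"
    using y z by (simp add: pseudoreach_order_iff reachable_iff)
  moreover have "(z, x) \<in> pseudoreach_order n"
    using z(1) by (auto simp: pseudoreach_order_def)
  ultimately show ?thesis using z(3) by blast
qed

lemma partial_order_on_pseudoreach: "partial_order_on (Sym n) (pseudoreach_order n)"
  unfolding partial_order_on_def preorder_on_def
proof (intro conjI)
  show "pseudoreach_order n \<subseteq> Sym n \<times> Sym n" by (auto simp: pseudoreach_order_iff)
  show "refl_on (Sym n) (pseudoreach_order n)" by (auto simp: refl_on_def pseudoreach_order_iff)
  show "trans (pseudoreach_order n)"
    by (rule transI) (auto simp: pseudoreach_order_iff intro: order_trans)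
  show "antisym (pseudoreach_order n)"
    by (rule antisymI) (auto simp: pseudoreach_order_iff intro!: code_inject intro: le_antisym)
qed

theorem theorem6p5:
  fixes n :: nat
  assumes "n \<ge> 1"
  shows "graded_poset (Sym n) (pseudoreach_order n) \<and>
         rank_function (Sym n) (pseudoreach_order n) perm_length"
proof (rule graded_by_descents[OF partial_order_on_pseudoreach])
  define lo hi where "lo = [1..<n + 1]" and "hi = rev [1..<n + 1]"
  then show lo: "lo \<in> Sym n" and hi: "hi \<in> Sym n"
    unfolding Sym_iff by (auto simp del: upt_Suc)
  have lo_nth: "lo ! i = i + 1" and hi_nth: "hi ! i = n - i" if "i < n" for i
    using that by (auto simp: lo_def hi_def rev_nth simp del: upt_Suc)
  have code_lo: "code lo j = 0" if "j < n" for j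
    using that by (simp add: code_def lo_nth)
  have "{i. i < j \<and> hi ! i > hi ! j} = {..<j}" if "j < n" for j
    using that by (auto simp: hi_nth)
  then have code_hi: "code hi j = j" if "j < n" for j
    using that by (simp add: code_def)
  show "perm_length lo = 0"
    by (simp add: perm_length_eq_sum_code length_Sym[OF lo] code_lo)
  fix x assume x: "x \<in> Sym n"
  show "(lo, x) \<in> pseudoreach_order n"
    using lo x unfolding pseudoreach_order_iff by (simp add: code_lo)
  have "code x j \<le> j" for j
    using card_mono[of "{..<j}" "{i. i < j \<and> x ! i > x ! j}"] by (auto simp: code_def)
  then show "(x, hi) \<in> pseudoreach_order n"
    using hi x unfolding pseudoreach_order_iff by (simp add: code_hi)
qed (rule pseudoreach_descent)

end
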